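(* Every quasi-continuous module satisfies the perspective-Schröder-Bernstein (PSB) property.
   Context: Rings are associative with unity and modules are unital. A module $M$ is quasi-continuous if it satisfies: $(C_1)$ every submodule of $M$ is essential in a direct summand of $M$; and $(C_3)$ if $M_1,M_2$ are direct summands of $M$ with $M_1\cap M_2=(0)$, then $M_1\oplus M_2$ is a direct summand of $M$. Write $A\subseteq^{\oplus}M$ if $A$ is a direct summand of $M$. Two direct summands $A,B$ of $M$ are perspective, written $A\sim_p B$, if there is a submodule $C$ with $M=A\oplus C=B\oplus C$. $M$ has the PSB-property if for any direct summands $A,B$ of $M$: whenever $A\sim_p B'$ for some $B'\subseteq^{\oplus}B$ and $B\sim_p A'$ for some $A'\subseteq^{\oplus}A$ (perspectivity taken in $M$), then $A\sim_p B$. *)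

theory Defs
  imports "HOL-Algebra.AbelCoset" "HOL-Algebra.Module"
begin

text \<open>
  The library locale \<open>module\<close> requires commutative scalars. The axioms below are the same
  over an arbitrary unital ring. Right modules over a ring are left modules over the opposite
  ring, so the choice of side loses nothing. The library locale \<open>submodule\<close> makes no
  assumption on the scalars and is used as it is.
\<close>

locale left_module = R?: ring + M?: abelian_group M for M (structure) +
  assumes smult_closed [simp, intro]:
      "\<lbrakk>a \<in> carrier R; x \<in> carrier M\<rbrakk> \<Longrightarrow> a \<odot>\<^bsub>M\<^esub> x \<in> carrier M"
    and smult_l_distr:
      "\<lbrakk>a \<in> carrier R; b \<in> carrier R; x \<in> carrier M\<rbrakk> \<Longrightarrow>
      (a \<oplus> b) \<odot>\<^bsub>M\<^esub> x = a \<odot>\<^bsub>M\<^esub> x \<oplus>\<^bsub>M\<^esub> b \<odot>\<^bsub>M\<^esub> x"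
    and smult_r_distr:
      "\<lbrakk>a \<in> carrier R; x \<in> carrier M; y \<in> carrier M\<rbrakk> \<Longrightarrow>
      a \<odot>\<^bsub>M\<^esub> (x \<oplus>\<^bsub>M\<^esub> y) = a \<odot>\<^bsub>M\<^esub> x \<oplus>\<^bsub>M\<^esub> a \<odot>\<^bsub>M\<^esub> y"
    and smult_assoc1:
      "\<lbrakk>a \<in> carrier R; b \<in> carrier R; x \<in> carrier M\<rbrakk> \<Longrightarrow>
      (a \<otimes> b) \<odot>\<^bsub>M\<^esub> x = a \<odot>\<^bsub>M\<^esub> (b \<odot>\<^bsub>M\<^esub> x)"
    and smult_one [simp]:
      "x \<in> carrier M \<Longrightarrow> \<one> \<odot>\<^bsub>M\<^esub> x = x"

lemma module_iff_left_module: "module R M \<longleftrightarrow> cring R \<and> left_module R M"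
  by (auto simp: module_def left_module_def module_axioms_def left_module_axioms_def
      cring.axioms(1))

text \<open>
  A submodule \<open>N\<close> of \<open>M\<close> is regarded as a module in its own right as
  \<open>M\<lparr>carrier := N\<rparr>\<close>, as in the library.
\<close>

lemma submodule_is_left_module:
  assumes "left_module R M" and "submodule N R M"
  shows "left_module R (M\<lparr>carrier := N\<rparr>)"
proof -
  interpret left_module R M by fact
  interpret N: submodule N R M by fact
  have sub: "x \<in> carrier M" if "x \<in> N" for x
    using N.subset that by auto
  have "comm_monoid ((add_monoid M)\<lparr>carrier := N\<rparr>)"
    using comm_monoid.submonoid_is_comm_monoid[OF M.a_comm_monoid N.subgroup_is_submonoid] .
  moreover have "group ((add_monoid M)\<lparr>carrier := N\<rparr>)"
    using N.subgroup_is_group[OF M.a_group] .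
  ultimately have "abelian_group (M\<lparr>carrier := N\<rparr>)"
    by (intro abelian_group.intro abelian_monoid.intro abelian_group_axioms.intro)
      (simp_all add: comm_group_def)
  then show ?thesis
    by (auto intro!: left_module.intro left_module_axioms.intro ring_axioms
        simp: sub smult_l_distr smult_r_distr smult_assoc1)
qed

definition internal_direct_sum ::
    "('r, 'p) ring_scheme \<Rightarrow> ('r, 'm, 'q) module_scheme \<Rightarrow> 'm set \<Rightarrow> 'm set \<Rightarrow> bool" where
  "internal_direct_sum R M A C \<longleftrightarrow>
     submodule A R M \<and> submodule C R M \<and> A \<inter> C = {\<zero>\<^bsub>M\<^esub>} \<and> A <+>\<^bsub>M\<^esub> C = carrier M"

definition direct_summand ::
    "('r, 'p) ring_scheme \<Rightarrow> ('r, 'm, 'q) module_scheme \<Rightarrow> 'm set \<Rightarrow> bool" where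
  "direct_summand R M A \<longleftrightarrow> (\<exists>C. internal_direct_sum R M A C)"

definition essential_submodule ::
    "('r, 'p) ring_scheme \<Rightarrow> ('r, 'm, 'q) module_scheme \<Rightarrow> 'm set \<Rightarrow> bool" where
  "essential_submodule R M N \<longleftrightarrow>
     submodule N R M \<and>
     (\<forall>K. submodule K R M \<and> K \<noteq> {\<zero>\<^bsub>M\<^esub>} \<longrightarrow> N \<inter> K \<noteq> {\<zero>\<^bsub>M\<^esub>})"

definition cond_C1 ::
    "('r, 'p) ring_scheme \<Rightarrow> ('r, 'm, 'q) module_scheme \<Rightarrow> bool" where
  "cond_C1 R M \<longleftrightarrow>
     (\<forall>N. submodule N R M \<longrightarrow>
        (\<exists>D. direct_summand R M D \<and> essential_submodule R (M\<lparr>carrier := D\<rparr>) N))"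

definition cond_C3 ::
    "('r, 'p) ring_scheme \<Rightarrow> ('r, 'm, 'q) module_scheme \<Rightarrow> bool" where
  "cond_C3 R M \<longleftrightarrow>
     (\<forall>A B. direct_summand R M A \<and> direct_summand R M B \<and> A \<inter> B = {\<zero>\<^bsub>M\<^esub>} \<longrightarrow>
        direct_summand R M (A <+>\<^bsub>M\<^esub> B))"

definition quasi_continuous ::
    "('r, 'p) ring_scheme \<Rightarrow> ('r, 'm, 'q) module_scheme \<Rightarrow> bool" where
  "quasi_continuous R M \<longleftrightarrow> cond_C1 R M \<and> cond_C3 R M"

definition perspective ::
    "('r, 'p) ring_scheme \<Rightarrow> ('r, 'm, 'q) module_scheme \<Rightarrow> 'm set \<Rightarrow> 'm set \<Rightarrow> bool" where
  "perspective R M A B \<longleftrightarrow>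
     (\<exists>C. internal_direct_sum R M A C \<and> internal_direct_sum R M B C)"

text \<open>
  In the next definition \<open>A'\<close> and \<open>B'\<close> are summands of the modules \<open>A\<close> and \<open>B\<close>,
  whereas perspectivity is always taken in the whole module \<open>M\<close>.
\<close>

definition PSB_property ::
    "('r, 'p) ring_scheme \<Rightarrow> ('r, 'm, 'q) module_scheme \<Rightarrow> bool" where
  "PSB_property R M \<longleftrightarrow>
     (\<forall>A B. direct_summand R M A \<and> direct_summand R M B \<and>
        (\<exists>B'. direct_summand R (M\<lparr>carrier := B\<rparr>) B' \<and> perspective R M A B') \<and>
        (\<exists>A'. direct_summand R (M\<lparr>carrier := A\<rparr>) A' \<and> perspective R M B A')
        \<longrightarrow> perspective R M A B)"

end

theory Submission
  imports Defs
begin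

text \<open>
  In a quasi-continuous module, summands \<open>A\<close> and \<open>B\<close> are perspective as soon as some submodule
  \<open>C\<close> is independent of both with \<open>A + C\<close> and \<open>B + C\<close> essential: by \<open>(C\<^sub>1)\<close> and \<open>(C\<^sub>3)\<close> a closure
  of \<open>C\<close> is a common complement. Let \<open>A\<^sub>1\<close> and \<open>B\<^sub>1\<close> complement \<open>A \<inter> B\<close> up to essentiality in \<open>A\<close>
  and \<open>B\<close>. The two perspectivities yield monomorphisms \<open>f : A\<^sub>1 \<rightarrow> B\<^sub>1\<close> and \<open>g : B\<^sub>1 \<rightarrow> A\<^sub>1\<close>, and a
  Schroeder-Bernstein argument in the style of Bumby gives an isomorphism between essential
  submodules of \<open>A\<^sub>1\<close> and \<open>B\<^sub>1\<close>: take \<open>X \<subseteq> A\<^sub>1\<close> maximal independent of \<open>g B\<^sub>1\<close>, let \<open>S\<close> be the least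
  submodule with \<open>S = X + g f S\<close>, take \<open>Y \<subseteq> B\<^sub>1\<close> maximal independent of \<open>f S\<close>, and use \<open>f\<close> on \<open>S\<close>
  and the inverse of \<open>g\<close> on \<open>g Y\<close>. Its graph plus a complement of \<open>A + B\<^sub>1\<close> serves as \<open>C\<close>.
\<close>

lemma summand_of_submodule_subset:
  "direct_summand R (M\<lparr>carrier := B\<rparr>) B' \<Longrightarrow> B' \<subseteq> B"
  using subgroup.subset[OF submodule.axioms(1)]
  by (fastforce simp: direct_summand_def internal_direct_sum_def)

context left_module
begin

section \<open>Submodules, their sums and the modular law\<close>

abbreviation sub :: "'c set \<Rightarrow> bool" where
  "sub N \<equiv> submodule N R M"

text \<open>Closure under negation is derived from \<open>smult\<close>, since -a = (-1) a.\<close>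

lemma subI:
  assumes "N \<subseteq> carrier M" "\<zero>\<^bsub>M\<^esub> \<in> N"
    and "\<And>a b. \<lbrakk>a \<in> N; b \<in> N\<rbrakk> \<Longrightarrow> a \<oplus>\<^bsub>M\<^esub> b \<in> N"
    and smult: "\<And>r a. \<lbrakk>r \<in> carrier R; a \<in> N\<rbrakk> \<Longrightarrow> r \<odot>\<^bsub>M\<^esub> a \<in> N"
  shows "sub N"
proof -
  have neg: "\<ominus>\<^bsub>M\<^esub> a \<in> N" if "a \<in> N" for a
  proof -
    have a: "a \<in> carrier M" using assms(1) that by blast
    have "(\<ominus> \<one>) \<odot>\<^bsub>M\<^esub> a \<oplus>\<^bsub>M\<^esub> a = (\<ominus> \<one> \<oplus> \<one>) \<odot>\<^bsub>M\<^esub> a"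
      using a by (simp add: smult_l_distr)
    also have "\<dots> = \<zero> \<odot>\<^bsub>M\<^esub> a" by (simp add: R.l_neg)
    also have "\<zero> \<odot>\<^bsub>M\<^esub> a = \<zero>\<^bsub>M\<^esub>"
    proof -
      have "\<zero> \<odot>\<^bsub>M\<^esub> a \<oplus>\<^bsub>M\<^esub> \<zero> \<odot>\<^bsub>M\<^esub> a = \<zero> \<odot>\<^bsub>M\<^esub> a"
        using a smult_l_distr[of \<zero> \<zero> a] by simp
      then show ?thesis
        using a M.add.l_cancel_one by auto
    qed
    finally have "\<ominus>\<^bsub>M\<^esub> a = (\<ominus> \<one>) \<odot>\<^bsub>M\<^esub> a"
      using a by (intro M.minus_equality) auto
    then show ?thesis using smult[of "\<ominus> \<one>" a] that by simp
  qed
  show ?thesis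
    using assms neg
    by (intro submodule.intro subgroup.intro submodule_axioms.intro)
      (auto simp: a_inv_def)
qed

lemma sub_subset: "sub N \<Longrightarrow> N \<subseteq> carrier M"
  using subgroup.subset[of N "add_monoid M"] by (auto simp: submodule_def)

lemma sub_carrier: "\<lbrakk>sub N; a \<in> N\<rbrakk> \<Longrightarrow> a \<in> carrier M"
  using sub_subset by blast

lemma sub_zero: "sub N \<Longrightarrow> \<zero>\<^bsub>M\<^esub> \<in> N"
  using subgroup.one_closed[of N "add_monoid M"] by (auto simp: submodule_def)

lemma sub_add: "\<lbrakk>sub N; a \<in> N; b \<in> N\<rbrakk> \<Longrightarrow> a \<oplus>\<^bsub>M\<^esub> b \<in> N"
  using subgroup.m_closed[of N "add_monoid M"] by (auto simp: submodule_def)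

lemma sub_neg: "\<lbrakk>sub N; a \<in> N\<rbrakk> \<Longrightarrow> \<ominus>\<^bsub>M\<^esub> a \<in> N"
  using subgroup.m_inv_closed[of N "add_monoid M"] by (auto simp: submodule_def a_inv_def)

lemma sub_smult: "\<lbrakk>sub N; r \<in> carrier R; a \<in> N\<rbrakk> \<Longrightarrow> r \<odot>\<^bsub>M\<^esub> a \<in> N"
  by (rule submodule.smult_closed)

lemma sub_cancel_right:
  assumes "sub N" "a \<in> carrier M" "b \<in> N" "a \<oplus>\<^bsub>M\<^esub> b \<in> N"
  shows "a \<in> N"
proof -
  have "a = (a \<oplus>\<^bsub>M\<^esub> b) \<oplus>\<^bsub>M\<^esub> \<ominus>\<^bsub>M\<^esub> b"
    using assms sub_carrier by (simp add: M.a_assoc M.r_neg)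
  then show ?thesis using assms sub_add sub_neg by metis
qed

lemma sub_cancel_left:
  assumes "sub N" "a \<in> carrier M" "b \<in> N" "b \<oplus>\<^bsub>M\<^esub> a \<in> N"
  shows "a \<in> N"
  using sub_cancel_right[of N a b] assms sub_carrier M.a_comm by metis

lemma sub_zeroI: "sub {\<zero>\<^bsub>M\<^esub>}"
proof (rule subI)
  fix r a assume r: "r \<in> carrier R" and "a \<in> {\<zero>\<^bsub>M\<^esub>}"
  then have a: "a = \<zero>\<^bsub>M\<^esub>" by simp
  have "r \<odot>\<^bsub>M\<^esub> a \<oplus>\<^bsub>M\<^esub> r \<odot>\<^bsub>M\<^esub> a = r \<odot>\<^bsub>M\<^esub> a"
    using smult_r_distr[of r a a] r a by simp
  then show "r \<odot>\<^bsub>M\<^esub> a \<in> {\<zero>\<^bsub>M\<^esub>}"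
    using r a M.add.l_cancel_one by auto
qed auto

lemma sub_top: "sub (carrier M)"
  by (rule subI) auto

lemma sub_Int: "\<lbrakk>sub U; sub V\<rbrakk> \<Longrightarrow> sub (U \<inter> V)"
  by (rule subI) (auto simp: sub_zero sub_add sub_smult dest: sub_carrier)

lemma mem_add: "x \<in> U <+>\<^bsub>M\<^esub> V \<longleftrightarrow> (\<exists>u\<in>U. \<exists>v\<in>V. x = u \<oplus>\<^bsub>M\<^esub> v)"
  by (auto simp: set_add_def')

lemma sub_sum:
  assumes U: "sub U" and V: "sub V"
  shows "sub (U <+>\<^bsub>M\<^esub> V)"
proof (rule subI)
  show "U <+>\<^bsub>M\<^esub> V \<subseteq> carrier M"
    using sub_carrier[OF U] sub_carrier[OF V] by (auto simp: mem_add)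
  show "\<zero>\<^bsub>M\<^esub> \<in> U <+>\<^bsub>M\<^esub> V"
    using sub_zero[OF U] sub_zero[OF V] by (force simp: mem_add)
next
  fix a b assume "a \<in> U <+>\<^bsub>M\<^esub> V" "b \<in> U <+>\<^bsub>M\<^esub> V"
  then obtain u v u' v' where uv: "u \<in> U" "v \<in> V" "u' \<in> U" "v' \<in> V"
    and ab: "a = u \<oplus>\<^bsub>M\<^esub> v" "b = u' \<oplus>\<^bsub>M\<^esub> v'"
    by (auto simp: mem_add)
  have "a \<oplus>\<^bsub>M\<^esub> b = (u \<oplus>\<^bsub>M\<^esub> u') \<oplus>\<^bsub>M\<^esub> (v \<oplus>\<^bsub>M\<^esub> v')"
    using uv ab sub_carrier[OF U] sub_carrier[OF V] by (simp add: M.a_ac)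
  then show "a \<oplus>\<^bsub>M\<^esub> b \<in> U <+>\<^bsub>M\<^esub> V"
    using uv sub_add[OF U] sub_add[OF V] unfolding mem_add by blast
next
  fix r a assume "r \<in> carrier R" "a \<in> U <+>\<^bsub>M\<^esub> V"
  then show "r \<odot>\<^bsub>M\<^esub> a \<in> U <+>\<^bsub>M\<^esub> V"
    using U V by (auto simp: mem_add) (metis smult_r_distr sub_carrier sub_smult)
qed

lemma sum_upper1: "\<lbrakk>sub U; sub V\<rbrakk> \<Longrightarrow> U \<subseteq> U <+>\<^bsub>M\<^esub> V"
  using sub_zero sub_carrier unfolding subset_iff mem_add by (metis M.r_zero)

lemma sum_upper2: "\<lbrakk>sub U; sub V\<rbrakk> \<Longrightarrow> V \<subseteq> U <+>\<^bsub>M\<^esub> V"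
  using sub_zero sub_carrier unfolding subset_iff mem_add by (metis M.l_zero)

lemma sum_least: "\<lbrakk>sub N; U \<subseteq> N; V \<subseteq> N\<rbrakk> \<Longrightarrow> U <+>\<^bsub>M\<^esub> V \<subseteq> N"
  using sub_add[of N] unfolding subset_iff mem_add by blast

lemma sum_mono: "\<lbrakk>U \<subseteq> U'; V \<subseteq> V'\<rbrakk> \<Longrightarrow> U <+>\<^bsub>M\<^esub> V \<subseteq> U' <+>\<^bsub>M\<^esub> V'"
  by (fastforce simp: mem_add)

lemma sum_comm: "\<lbrakk>sub U; sub V\<rbrakk> \<Longrightarrow> U <+>\<^bsub>M\<^esub> V = V <+>\<^bsub>M\<^esub> U"
  using sub_carrier M.a_comm unfolding set_eq_iff mem_add by metis

lemma sum_assoc: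
  "\<lbrakk>sub U; sub V; sub W\<rbrakk> \<Longrightarrow> (U <+>\<^bsub>M\<^esub> V) <+>\<^bsub>M\<^esub> W = U <+>\<^bsub>M\<^esub> (V <+>\<^bsub>M\<^esub> W)"
  by (simp add: set_add_def M.add.set_mult_assoc sub_subset)

lemma modular_law:
  assumes "sub N" "sub U" "sub V" "U \<subseteq> N"
  shows "N \<inter> (U <+>\<^bsub>M\<^esub> V) \<subseteq> U <+>\<^bsub>M\<^esub> (N \<inter> V)"
proof
  fix x assume "x \<in> N \<inter> (U <+>\<^bsub>M\<^esub> V)"
  then obtain u v where "u \<in> U" "v \<in> V" "x = u \<oplus>\<^bsub>M\<^esub> v" "x \<in> N"
    by (auto simp: mem_add)
  moreover from this have "v \<in> N"
    using sub_cancel_left[of N v u] assms sub_carrier by blast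
  ultimately show "x \<in> U <+>\<^bsub>M\<^esub> (N \<inter> V)" by (auto simp: mem_add)
qed

section \<open>Independence, essentiality and complements\<close>

text \<open>For submodules this is trivial intersection. Inclusion in place of equality makes
  \<open>indep_mono\<close> free of side conditions.\<close>

definition indep :: "'c set \<Rightarrow> 'c set \<Rightarrow> bool" where
  "indep U V \<longleftrightarrow> U \<inter> V \<subseteq> {\<zero>\<^bsub>M\<^esub>}"

lemma indep_sym: "indep U V \<Longrightarrow> indep V U"
  by (auto simp: indep_def)

lemma indep_mono: "\<lbrakk>indep U V; U' \<subseteq> U; V' \<subseteq> V\<rbrakk> \<Longrightarrow> indep U' V'"
  by (auto simp: indep_def)

lemma indepD: "\<lbrakk>indep U V; x \<in> U; x \<in> V\<rbrakk> \<Longrightarrow> x = \<zero>\<^bsub>M\<^esub>"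
  by (auto simp: indep_def)

lemma indep_Int_eq: "\<lbrakk>indep U V; sub U; sub V\<rbrakk> \<Longrightarrow> U \<inter> V = {\<zero>\<^bsub>M\<^esub>}"
  using sub_zero by (auto simp: indep_def)

text \<open>The hypotheses say that the sum of \<open>K\<close>, \<open>U\<close> and
  \<open>V\<close> is direct, a condition symmetric in the three. From v = k + u one gets k in
  \<open>U + V\<close>, hence k = 0 and v = u = 0.\<close>

lemma indep_rotate:
  assumes "sub K" "sub U" "sub V" "indep U V" "indep K (U <+>\<^bsub>M\<^esub> V)"
  shows "indep (K <+>\<^bsub>M\<^esub> U) V"
  unfolding indep_def
proof
  fix v assume "v \<in> (K <+>\<^bsub>M\<^esub> U) \<inter> V"
  then obtain k u where ku: "k \<in> K" "u \<in> U" and v: "v = k \<oplus>\<^bsub>M\<^esub> u" "v \<in> V"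
    by (auto simp: mem_add)
  have "k \<in> U <+>\<^bsub>M\<^esub> V"
    using sub_cancel_right[of "U <+>\<^bsub>M\<^esub> V" k u] ku v sub_sum[of U V]
      sum_upper1[of U V] sum_upper2[of U V] assms sub_carrier by blast
  then have "k = \<zero>\<^bsub>M\<^esub>" using assms ku indepD by blast
  then have "v = u" using v ku assms sub_carrier by auto
  then show "v \<in> {\<zero>\<^bsub>M\<^esub>}" using v ku assms indepD by blast
qed

text \<open>
  For \<open>N \<subseteq> D\<close> the following says that \<open>N\<close> is essential in \<open>D\<close>; letting \<open>K\<close> range over all
  submodules of \<open>M\<close> makes the relation transitive and monotone in both arguments.
\<close>

definition ess :: "'c set \<Rightarrow> 'c set \<Rightarrow> bool" where
  "ess N D \<longleftrightarrow> (\<forall>K. sub K \<longrightarrow> indep K N \<longrightarrow> indep K D)"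

lemma essD: "\<lbrakk>ess N D; sub K; indep K N\<rbrakk> \<Longrightarrow> indep K D"
  by (auto simp: ess_def)

lemma ess_trans: "\<lbrakk>ess U V; ess V W\<rbrakk> \<Longrightarrow> ess U W"
  by (auto simp: ess_def)

lemma ess_mono: "\<lbrakk>ess N D; N \<subseteq> N'; D' \<subseteq> D\<rbrakk> \<Longrightarrow> ess N' D'"
  unfolding ess_def using indep_mono by (meson order_refl)

text \<open>\<open>indep_rotate\<close> moves \<open>L\<close> to the side of the test submodule:
  \<open>K + L\<close> avoids \<open>N\<close>, hence \<open>D\<close>. An element k = d + l of
  \<open>K\<close> then has d in both \<open>K + L\<close> and \<open>D\<close>, so d = 0 and k
  already lies in \<open>N + L\<close>.\<close>

lemma ess_sum:
  assumes sub: "sub N" "sub D" "sub L" and "N \<subseteq> D" "ess N D" "indep N L"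
  shows "ess (N <+>\<^bsub>M\<^esub> L) (D <+>\<^bsub>M\<^esub> L)"
  unfolding ess_def
proof (intro allI impI)
  fix K assume K: "sub K" "indep K (N <+>\<^bsub>M\<^esub> L)"
  have "indep K (L <+>\<^bsub>M\<^esub> N)"
    using K sum_comm sub by simp
  then have "indep (K <+>\<^bsub>M\<^esub> L) N"
    using indep_rotate[of K L N] sub K assms indep_sym by blast
  then have KLD: "indep (K <+>\<^bsub>M\<^esub> L) D"
    using essD assms sub_sum K by blast
  show "indep K (D <+>\<^bsub>M\<^esub> L)"
    unfolding indep_def
  proof
    fix k assume "k \<in> K \<inter> (D <+>\<^bsub>M\<^esub> L)"
    then obtain d l where dl: "d \<in> D" "l \<in> L" "k = d \<oplus>\<^bsub>M\<^esub> l" "k \<in> K"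
      by (auto simp: mem_add)
    then have "d \<in> K <+>\<^bsub>M\<^esub> L"
      using sub_cancel_right[of "K <+>\<^bsub>M\<^esub> L" d l] sum_upper1[of K L] sum_upper2[of K L]
        sub_sum[of K L] K sub sub_carrier by blast
    then have "d = \<zero>\<^bsub>M\<^esub>" using KLD dl indepD by blast
    then have "k = l" using dl sub sub_carrier by auto
    then have "k \<in> N <+>\<^bsub>M\<^esub> L" using dl sum_upper2[of N L] sub by blast
    then show "k \<in> {\<zero>\<^bsub>M\<^esub>}" using K dl indepD by blast
  qed
qed

text \<open>Zorn's lemma gives a maximal \<open>X\<close>; a submodule of \<open>A\<close>
  independent of \<open>X + N\<close> could be added to \<open>X\<close>, so maximality forces it to
  be zero.\<close>

lemma ex_complement:
  assumes "sub A" "sub N"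
  shows "\<exists>X. sub X \<and> X \<subseteq> A \<and> indep X N \<and> ess (X <+>\<^bsub>M\<^esub> N) A"
proof -
  let ?F = "{X. sub X \<and> X \<subseteq> A \<and> indep X N}"
  have "\<exists>X\<in>?F. \<forall>Y\<in>?F. X \<subseteq> Y \<longrightarrow> Y = X"
  proof (rule subset_Zorn_nonempty)
    have "{\<zero>\<^bsub>M\<^esub>} \<in> ?F" using sub_zeroI sub_zero[OF assms(1)] by (auto simp: indep_def)
    then show "?F \<noteq> {}" by blast
  next
    fix \<C> assume ne: "\<C> \<noteq> {}" and ch: "subset.chain ?F \<C>"
    have C: "sub X" "X \<subseteq> A" "indep X N" if "X \<in> \<C>" for X
      using ch that by (auto simp: subset_chain_def)
    have "sub (\<Union>\<C>)"
    proof (rule subI)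
      show "\<Union>\<C> \<subseteq> carrier M" using C sub_subset by blast
      show "\<zero>\<^bsub>M\<^esub> \<in> \<Union>\<C>" using ne C sub_zero by blast
      show "r \<odot>\<^bsub>M\<^esub> a \<in> \<Union>\<C>" if "r \<in> carrier R" "a \<in> \<Union>\<C>" for r a
        using that C sub_smult by blast
      fix a b assume "a \<in> \<Union>\<C>" "b \<in> \<Union>\<C>"
      then obtain X Y where "X \<in> \<C>" "Y \<in> \<C>" "a \<in> X" "b \<in> Y" by blast
      moreover from this have "X \<subseteq> Y \<or> Y \<subseteq> X"
        using ch by (auto simp: subset_chain_def)
      ultimately show "a \<oplus>\<^bsub>M\<^esub> b \<in> \<Union>\<C>" using C sub_add by blast
    qed
    then show "\<Union>\<C> \<in> ?F" using C unfolding indep_def by blast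
  qed
  then obtain X where X: "sub X" "X \<subseteq> A" "indep X N"
    and max: "\<And>Y. \<lbrakk>sub Y; Y \<subseteq> A; indep Y N; X \<subseteq> Y\<rbrakk> \<Longrightarrow> Y = X"
    by auto
  have "indep K A" if K: "sub K" "indep K (X <+>\<^bsub>M\<^esub> N)" for K
  proof -
    \<comment> \<open>Only the part of \<open>K\<close> inside \<open>A\<close> matters, and
      competitors of \<open>X\<close> must lie in \<open>A\<close>.\<close>
    let ?K = "K \<inter> A"
    have K': "sub ?K" using K assms sub_Int by blast
    have "indep ?K (X <+>\<^bsub>M\<^esub> N)" using K(2) indep_mono by blast
    then have "indep (?K <+>\<^bsub>M\<^esub> X) N"
      using indep_rotate K' X assms by blast
    then have "?K <+>\<^bsub>M\<^esub> X = X"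
      using X assms K' by (intro max sub_sum sum_least sum_upper2) auto
    then have "?K \<subseteq> X <+>\<^bsub>M\<^esub> N"
      using sum_upper1[of ?K X] sum_upper1[of X N] K' X assms by blast
    then show ?thesis using K(2) unfolding indep_def by blast
  qed
  then show ?thesis using X by (auto simp: ess_def)
qed

section \<open>Endomorphisms, images and trivial kernels\<close>

text \<open>The maps between submodules all arise by composing and restricting projections of
  \<open>M\<close>, so linear maps on the whole module suffice and no domains need tracking.\<close>

definition endo :: "('c \<Rightarrow> 'c) \<Rightarrow> bool" where
  "endo f \<longleftrightarrow> (\<forall>x\<in>carrier M. f x \<in> carrier M) \<and>
     (\<forall>x\<in>carrier M. \<forall>y\<in>carrier M. f (x \<oplus>\<^bsub>M\<^esub> y) = f x \<oplus>\<^bsub>M\<^esub> f y) \<and>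
     (\<forall>r\<in>carrier R. \<forall>x\<in>carrier M. f (r \<odot>\<^bsub>M\<^esub> x) = r \<odot>\<^bsub>M\<^esub> f x)"

lemma endo_closed: "\<lbrakk>endo f; x \<in> carrier M\<rbrakk> \<Longrightarrow> f x \<in> carrier M"
  and endo_add: "\<lbrakk>endo f; x \<in> carrier M; y \<in> carrier M\<rbrakk> \<Longrightarrow> f (x \<oplus>\<^bsub>M\<^esub> y) = f x \<oplus>\<^bsub>M\<^esub> f y"
  and endo_smult: "\<lbrakk>endo f; r \<in> carrier R; x \<in> carrier M\<rbrakk> \<Longrightarrow> f (r \<odot>\<^bsub>M\<^esub> x) = r \<odot>\<^bsub>M\<^esub> f x"
  by (auto simp: endo_def)

lemma endo_zero: "endo f \<Longrightarrow> f \<zero>\<^bsub>M\<^esub> = \<zero>\<^bsub>M\<^esub>"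
  using endo_add[of f "\<zero>\<^bsub>M\<^esub>" "\<zero>\<^bsub>M\<^esub>"] endo_closed[of f "\<zero>\<^bsub>M\<^esub>"] M.add.l_cancel_one by auto

lemma endo_neg: "\<lbrakk>endo f; x \<in> carrier M\<rbrakk> \<Longrightarrow> f (\<ominus>\<^bsub>M\<^esub> x) = \<ominus>\<^bsub>M\<^esub> f x"
  using endo_add[of f "\<ominus>\<^bsub>M\<^esub> x" x] endo_closed[of f] endo_zero[of f]
  by (intro M.minus_equality[symmetric]) (auto simp: M.l_neg)

lemma endo_comp: "\<lbrakk>endo f; endo g\<rbrakk> \<Longrightarrow> endo (\<lambda>x. g (f x))"
  by (auto simp: endo_def)

lemma endo_id_add: "endo f \<Longrightarrow> endo (\<lambda>x. x \<oplus>\<^bsub>M\<^esub> f x)"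
  by (auto simp: endo_def smult_r_distr M.a_ac)

lemma sub_image:
  assumes "endo f" "sub U"
  shows "sub (f ` U)"
proof (rule subI)
  show "f ` U \<subseteq> carrier M" using assms sub_carrier endo_closed by blast
  show "\<zero>\<^bsub>M\<^esub> \<in> f ` U" using assms sub_zero endo_zero by (metis imageI)
  show "a \<oplus>\<^bsub>M\<^esub> b \<in> f ` U" if ab: "a \<in> f ` U" "b \<in> f ` U" for a b
  proof -
    obtain u v where uv: "u \<in> U" "v \<in> U" "a = f u" "b = f v" using ab by auto
    then have "a \<oplus>\<^bsub>M\<^esub> b = f (u \<oplus>\<^bsub>M\<^esub> v)" using assms sub_carrier endo_add by simp
    then show ?thesis using uv assms sub_add by blast
  qed
  show "r \<odot>\<^bsub>M\<^esub> a \<in> f ` U" if ra: "r \<in> carrier R" "a \<in> f ` U" for r a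
  proof -
    obtain u where u: "u \<in> U" "a = f u" using ra by auto
    then have "r \<odot>\<^bsub>M\<^esub> a = f (r \<odot>\<^bsub>M\<^esub> u)" using ra assms sub_carrier endo_smult by simp
    then show ?thesis using u ra assms sub_smult by blast
  qed
qed

lemma sub_vimage:
  assumes "endo f" "sub U" "sub K"
  shows "sub {u\<in>U. f u \<in> K}"
  using assms
  by (intro subI) (auto simp: sub_zero endo_zero sub_add endo_add sub_smult endo_smult sub_carrier)

lemma image_sum:
  assumes "endo f" "sub U" "sub V"
  shows "f ` (U <+>\<^bsub>M\<^esub> V) = f ` U <+>\<^bsub>M\<^esub> f ` V"
proof -
  have "f (u \<oplus>\<^bsub>M\<^esub> v) = f u \<oplus>\<^bsub>M\<^esub> f v" if "u \<in> U" "v \<in> V" for u v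
    using that assms endo_add sub_carrier by blast
  then show ?thesis by (force simp: mem_add image_iff)
qed

text \<open>For an endomorphism and a submodule this is injectivity on \<open>U\<close>, as
  \<open>inj_kernel_eq\<close> shows.\<close>

definition inj_kernel :: "('c \<Rightarrow> 'c) \<Rightarrow> 'c set \<Rightarrow> bool" where
  "inj_kernel f U \<longleftrightarrow> (\<forall>u\<in>U. f u = \<zero>\<^bsub>M\<^esub> \<longrightarrow> u = \<zero>\<^bsub>M\<^esub>)"

lemma inj_kernelD: "\<lbrakk>inj_kernel f U; u \<in> U; f u = \<zero>\<^bsub>M\<^esub>\<rbrakk> \<Longrightarrow> u = \<zero>\<^bsub>M\<^esub>"
  by (auto simp: inj_kernel_def)

text \<open>Test submodules are pulled back: the preimage of \<open>K\<close> in \<open>V\<close>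
  avoids \<open>U\<close>, hence is zero by essentiality.\<close>

lemma ess_image:
  assumes "endo f" "sub U" "sub V" "U \<subseteq> V" "ess U V" and inj: "inj_kernel f V"
  shows "ess (f ` U) (f ` V)"
  unfolding ess_def
proof (intro allI impI)
  fix K assume K: "sub K" "indep K (f ` U)"
  let ?K = "{v\<in>V. f v \<in> K}"
  have "indep ?K U"
    using K(2) assms(4) inj unfolding indep_def inj_kernel_def by blast
  then have "indep ?K V"
    using essD assms K sub_vimage by blast
  then show "indep K (f ` V)"
    using endo_zero[OF assms(1)] unfolding indep_def by auto
qed

section \<open>The Schroeder-Bernstein argument up to essentiality\<close>

text \<open>
  A submodule \<open>G\<close> of \<open>A + B\<close> meeting both \<open>A\<close> and \<open>B\<close> trivially is the graph of an isomorphism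
  between submodules of \<open>A\<close> and \<open>B\<close>, namely \<open>(G + B) \<inter> A\<close> and \<open>(G + A) \<inter> B\<close>.
\<close>

definition ess_graph :: "'c set \<Rightarrow> 'c set \<Rightarrow> 'c set \<Rightarrow> bool" where
  "ess_graph A B G \<longleftrightarrow> sub G \<and> G \<subseteq> A <+>\<^bsub>M\<^esub> B \<and> indep G A \<and> indep G B \<and>
     ess ((G <+>\<^bsub>M\<^esub> B) \<inter> A) A \<and> ess ((G <+>\<^bsub>M\<^esub> A) \<inter> B) B"

text \<open>A Knaster-Tarski fixed point: \<open>S\<close> is the least \<open>h\<close>-stable
  submodule containing \<open>X\<close>. Since \<open>X + h S\<close> is again such a submodule and
  lies in \<open>S\<close>, the two coincide.\<close>

lemma least_stable:
  assumes h: "endo h" and X: "sub X" "X \<subseteq> A" and A: "sub A" "h ` A \<subseteq> A"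
  shows "\<exists>S. sub S \<and> S \<subseteq> A \<and> S = X <+>\<^bsub>M\<^esub> h ` S"
proof -
  define F where "F = {N. sub N \<and> X \<subseteq> N \<and> h ` N \<subseteq> N}"
  define S where "S = \<Inter>F"
  have AF: "A \<in> F" using assms by (auto simp: F_def)
  have S: "sub S"
    unfolding S_def
  proof (rule subI)
    show "\<Inter>F \<subseteq> carrier M" using AF A sub_subset by blast
    show "\<zero>\<^bsub>M\<^esub> \<in> \<Inter>F" by (auto simp: F_def sub_zero)
    show "a \<oplus>\<^bsub>M\<^esub> b \<in> \<Inter>F" if "a \<in> \<Inter>F" "b \<in> \<Inter>F" for a b
      using that by (auto simp: F_def sub_add)
    show "r \<odot>\<^bsub>M\<^esub> a \<in> \<Inter>F" if "r \<in> carrier R" "a \<in> \<Inter>F" for r a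
      using that by (auto simp: F_def sub_smult)
  qed
  have XS: "X \<subseteq> S" and hS: "h ` S \<subseteq> S" by (auto simp: S_def F_def)
  let ?T = "X <+>\<^bsub>M\<^esub> h ` S"
  have T: "sub ?T" "?T \<subseteq> S" using sub_sum sub_image sum_least S X h XS hS by auto
  have "h ` ?T \<subseteq> ?T"
    using T(2) sum_upper2[of X "h ` S"] sub_image h S X by blast
  then have "?T \<in> F"
    using T(1) sum_upper1[of X "h ` S"] sub_image h S X by (auto simp: F_def)
  then have "S = ?T" using T(2) by (auto simp: S_def)
  moreover have "S \<subseteq> A" using AF by (auto simp: S_def)
  ultimately show ?thesis using S by blast
qed

lemma inj_kernel_eq:
  assumes "endo f" "inj_kernel f U" "sub U" "u \<in> U" "v \<in> U" "f u = f v"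
  shows "u = v"
proof -
  have uv: "u \<in> carrier M" "v \<in> carrier M" using assms sub_carrier by auto
  have "f (u \<oplus>\<^bsub>M\<^esub> \<ominus>\<^bsub>M\<^esub> v) = \<zero>\<^bsub>M\<^esub>"
    using assms uv by (simp add: endo_add endo_neg endo_closed M.r_neg)
  then have "u \<oplus>\<^bsub>M\<^esub> \<ominus>\<^bsub>M\<^esub> v = \<zero>\<^bsub>M\<^esub>"
    using assms sub_add sub_neg inj_kernelD by metis
  then show ?thesis using uv M.minus_equality[of u "\<ominus>\<^bsub>M\<^esub> v"] by simp
qed

text \<open>The isomorphism sends s + g y to f s + y, from \<open>S + g Y\<close> onto
  \<open>f S + Y\<close>; both are essential, in \<open>A\<close> and \<open>B\<close>
  respectively.\<close>

lemma ex_ess_graph: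
  assumes f: "endo f" "f ` A \<subseteq> B" "inj_kernel f A"
    and g: "endo g" "g ` B \<subseteq> A" "inj_kernel g B"
    and A: "sub A" and B: "sub B" and AB: "indep A B"
  shows "\<exists>G. ess_graph A B G"
proof -
  have gB: "sub (g ` B)" using sub_image g B by blast
  obtain X where X: "sub X" "X \<subseteq> A" "indep X (g ` B)" "ess (X <+>\<^bsub>M\<^esub> g ` B) A"
    using ex_complement[OF A gB] by blast
  obtain S where S: "sub S" "S \<subseteq> A" and S_eq: "S = X <+>\<^bsub>M\<^esub> (\<lambda>x. g (f x)) ` S"
    using least_stable[OF endo_comp[OF f(1) g(1)] X(1,2) A] f(2) g(2) by auto
  have fS: "sub (f ` S)" "f ` S \<subseteq> B" using sub_image f S by blast+
  obtain Y where Y: "sub Y" "Y \<subseteq> B" "indep Y (f ` S)" "ess (Y <+>\<^bsub>M\<^esub> f ` S) B"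
    using ex_complement[OF B fS(1)] by blast
  have gY: "sub (g ` Y)" "g ` Y \<subseteq> A" using sub_image g Y by blast+
  note carr = sub_carrier[OF A] sub_carrier[OF B]
  \<comment> \<open>If s = g y = x + g (f s'), then x lies in \<open>g B\<close>, so x = 0;
    injectivity of \<open>g\<close> gives y = f s', which lies in both \<open>Y\<close> and
    \<open>f S\<close> and is therefore zero.\<close>
  have SY: "indep S (g ` Y)"
    unfolding indep_def
  proof
    fix s assume "s \<in> S \<inter> g ` Y"
    then obtain y where y: "y \<in> Y" "s = g y" "s \<in> S" by blast
    then have "s \<in> X <+>\<^bsub>M\<^esub> (\<lambda>x. g (f x)) ` S" using S_eq by blast
    then obtain x s' where s': "x \<in> X" "s' \<in> S" "s = x \<oplus>\<^bsub>M\<^esub> g (f s')"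
      unfolding mem_add by blast
    have "x \<in> g ` B"
      using sub_cancel_right[OF gB, of x "g (f s')"] s' y Y(2) fS(2) X(1) sub_carrier by blast
    then have "x = \<zero>\<^bsub>M\<^esub>" using X(3) s' indepD by blast
    moreover have fs': "f s' \<in> B" using fS s' by blast
    ultimately have "g y = g (f s')" using s' y carr g(1) endo_closed by simp
    then have "y = f s'" using inj_kernel_eq[OF g(1,3) B] y Y(2) fs' by blast
    then have "y = \<zero>\<^bsub>M\<^esub>" using Y(3) y s' indepD by blast
    then show "s \<in> {\<zero>\<^bsub>M\<^esub>}" using y g endo_zero by simp
  qed
  \<comment> \<open>Applying \<open>g\<close> to \<open>Y + f S\<close> gives an essential submodule
    of \<open>g B\<close>, and adding \<open>X\<close> one of \<open>A\<close>. It lies in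
    \<open>S + g Y\<close> because \<open>S\<close> contains \<open>X\<close> and
    \<open>g f S\<close>.\<close>
  have essA: "ess (S <+>\<^bsub>M\<^esub> g ` Y) A"
  proof -
    let ?U = "Y <+>\<^bsub>M\<^esub> f ` S"
    have U: "sub ?U" "?U \<subseteq> B" using sub_sum sum_least Y fS B by auto
    have gU: "sub (g ` ?U)" "g ` ?U \<subseteq> g ` B" using sub_image g U by blast+
    have "ess (g ` ?U) (g ` B)" using ess_image[OF g(1) U(1) B U(2) Y(4) g(3)] .
    moreover have "indep (g ` ?U) X" using indep_mono[OF indep_sym[OF X(3)] gU(2) order_refl] .
    ultimately have "ess (g ` ?U <+>\<^bsub>M\<^esub> X) (g ` B <+>\<^bsub>M\<^esub> X)"
      using ess_sum[OF gU(1) gB X(1) gU(2)] by blast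
    then have ess: "ess (g ` ?U <+>\<^bsub>M\<^esub> X) A"
      using X(4) ess_trans sum_comm[OF gB X(1)] by simp
    have SgY: "sub (S <+>\<^bsub>M\<^esub> g ` Y)" using sub_sum S gY by blast
    have gfS: "sub ((\<lambda>x. g (f x)) ` S)" using sub_image[OF endo_comp[OF f(1) g(1)] S(1)] .
    have "X \<subseteq> S" "(\<lambda>x. g (f x)) ` S \<subseteq> S"
      using S_eq sum_upper1[OF X(1) gfS] sum_upper2[OF X(1) gfS] by auto
    then have "X \<subseteq> S <+>\<^bsub>M\<^esub> g ` Y" "g ` f ` S \<subseteq> S <+>\<^bsub>M\<^esub> g ` Y" "g ` Y \<subseteq> S <+>\<^bsub>M\<^esub> g ` Y"
      using sum_upper1[OF S(1) gY(1)] sum_upper2[OF S(1) gY(1)] by auto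
    then have "g ` ?U <+>\<^bsub>M\<^esub> X \<subseteq> S <+>\<^bsub>M\<^esub> g ` Y"
      using image_sum[OF g(1) Y(1) fS(1)] sum_least SgY by simp
    then show ?thesis using ess ess_mono by blast
  qed
  \<comment> \<open>The graph of s + g y |-> f s + y is the sum of the graph of \<open>f\<close> on
    \<open>S\<close> and the flipped graph of \<open>g\<close> on \<open>Y\<close>.\<close>
  define G where "G = (\<lambda>x. x \<oplus>\<^bsub>M\<^esub> f x) ` S <+>\<^bsub>M\<^esub> (\<lambda>y. y \<oplus>\<^bsub>M\<^esub> g y) ` Y"
  have SY': "sub ((\<lambda>x. x \<oplus>\<^bsub>M\<^esub> f x) ` S)" "sub ((\<lambda>y. y \<oplus>\<^bsub>M\<^esub> g y) ` Y)"
    using sub_image endo_id_add f g S Y by blast+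
  have G: "sub G" unfolding G_def using sub_sum SY' by blast
  have GS: "s \<oplus>\<^bsub>M\<^esub> f s \<in> G" if "s \<in> S" for s
    using sum_upper1[OF SY'] that unfolding G_def by blast
  have GY: "y \<oplus>\<^bsub>M\<^esub> g y \<in> G" if "y \<in> Y" for y
    using sum_upper2[OF SY'] that unfolding G_def by blast
  \<comment> \<open>Regrouping separates the component in \<open>A\<close> from the one in
    \<open>B\<close>. For an element of \<open>G\<close> lying in \<open>A\<close> or in
    \<open>B\<close>, the component on the other side vanishes.\<close>
  have elem: "\<exists>s\<in>S. \<exists>y\<in>Y. x = (s \<oplus>\<^bsub>M\<^esub> g y) \<oplus>\<^bsub>M\<^esub> (f s \<oplus>\<^bsub>M\<^esub> y)" if x: "x \<in> G" for x
  proof -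
    obtain s y where sy: "s \<in> S" "y \<in> Y" "x = (s \<oplus>\<^bsub>M\<^esub> f s) \<oplus>\<^bsub>M\<^esub> (y \<oplus>\<^bsub>M\<^esub> g y)"
      using x unfolding G_def by (auto simp: mem_add)
    moreover have "s \<in> carrier M" "y \<in> carrier M" "f s \<in> carrier M" "g y \<in> carrier M"
      using sy S Y fS(2) gY(2) carr by blast+
    ultimately have "x = (s \<oplus>\<^bsub>M\<^esub> g y) \<oplus>\<^bsub>M\<^esub> (f s \<oplus>\<^bsub>M\<^esub> y)"
      by (simp add: M.a_ac)
    then show ?thesis using sy by blast
  qed
  have parts: "s \<oplus>\<^bsub>M\<^esub> g y \<in> A" "f s \<oplus>\<^bsub>M\<^esub> y \<in> B" if "s \<in> S" "y \<in> Y" for s y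
    using that S Y fS(2) gY(2) sub_add[OF A] sub_add[OF B] by blast+
  have "G \<subseteq> A <+>\<^bsub>M\<^esub> B"
    using elem parts unfolding subset_iff mem_add by blast
  moreover have "indep G A"
    unfolding indep_def
  proof
    fix x assume x: "x \<in> G \<inter> A"
    then obtain s y where sy: "s \<in> S" "y \<in> Y" "x = (s \<oplus>\<^bsub>M\<^esub> g y) \<oplus>\<^bsub>M\<^esub> (f s \<oplus>\<^bsub>M\<^esub> y)"
      using elem by blast
    then have "f s \<oplus>\<^bsub>M\<^esub> y \<in> A"
      using sub_cancel_left[OF A, of "f s \<oplus>\<^bsub>M\<^esub> y" "s \<oplus>\<^bsub>M\<^esub> g y"] x parts carr by blast
    then have z: "f s \<oplus>\<^bsub>M\<^esub> y = \<zero>\<^bsub>M\<^esub>" using AB parts sy indepD by blast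
    have fs: "f s \<in> carrier M" using sy fS(2) carr by blast
    then have "f s \<in> Y" using sub_cancel_right[OF Y(1), of "f s" y] z sy sub_zero[OF Y(1)] by simp
    then have fs0: "f s = \<zero>\<^bsub>M\<^esub>" using Y(3) sy indepD by blast
    then have "s = \<zero>\<^bsub>M\<^esub>" using f(3) inj_kernelD sy S by blast
    moreover have "y = \<zero>\<^bsub>M\<^esub>" using z fs0 sy Y(1) sub_carrier by auto
    ultimately show "x \<in> {\<zero>\<^bsub>M\<^esub>}" using sy endo_zero[OF f(1)] endo_zero[OF g(1)] by simp
  qed
  moreover have "indep G B"
    unfolding indep_def
  proof
    fix x assume x: "x \<in> G \<inter> B"
    then obtain s y where sy: "s \<in> S" "y \<in> Y" "x = (s \<oplus>\<^bsub>M\<^esub> g y) \<oplus>\<^bsub>M\<^esub> (f s \<oplus>\<^bsub>M\<^esub> y)"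
      using elem by blast
    then have "s \<oplus>\<^bsub>M\<^esub> g y \<in> B"
      using sub_cancel_right[OF B, of "s \<oplus>\<^bsub>M\<^esub> g y" "f s \<oplus>\<^bsub>M\<^esub> y"] x parts carr by blast
    then have z: "s \<oplus>\<^bsub>M\<^esub> g y = \<zero>\<^bsub>M\<^esub>" using AB parts sy indepD by blast
    have s: "s \<in> carrier M" "g y \<in> carrier M" using sy S(2) gY(2) carr by blast+
    then have "s \<in> g ` Y"
      using sub_cancel_right[OF gY(1), of s "g y"] z sy sub_zero[OF gY(1)] by simp
    then have s0: "s = \<zero>\<^bsub>M\<^esub>" using SY sy indepD by blast
    then have "g y = \<zero>\<^bsub>M\<^esub>" using z s by simp
    then have "y = \<zero>\<^bsub>M\<^esub>" using g(3) inj_kernelD sy Y by blast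
    then show "x \<in> {\<zero>\<^bsub>M\<^esub>}" using s0 sy endo_zero[OF f(1)] endo_zero[OF g(1)] by simp
  qed
  moreover have "ess ((G <+>\<^bsub>M\<^esub> B) \<inter> A) A"
  proof -
    have GB: "sub (G <+>\<^bsub>M\<^esub> B)" "G \<subseteq> G <+>\<^bsub>M\<^esub> B" "B \<subseteq> G <+>\<^bsub>M\<^esub> B"
      using sub_sum sum_upper1 sum_upper2 G B by auto
    \<comment> \<open>Here s = (s + f s) - f s, with the first term in \<open>G\<close> and the
      second in \<open>B\<close>; the elements g y and the other side are recovered
      likewise.\<close>
    have "s \<in> G <+>\<^bsub>M\<^esub> B" if "s \<in> S" for s
      using sub_cancel_right[OF GB(1), of s "f s"] GS[OF that] that fS(2) GB S(1) sub_carrier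
      by blast
    moreover have "g y \<in> G <+>\<^bsub>M\<^esub> B" if "y \<in> Y" for y
      using sub_cancel_left[OF GB(1), of "g y" y] GY[OF that] that GB Y(2) gY(1) sub_carrier
      by blast
    ultimately have "S <+>\<^bsub>M\<^esub> g ` Y \<subseteq> (G <+>\<^bsub>M\<^esub> B) \<inter> A"
      using S gY GB A by (intro sum_least sub_Int) auto
    then show ?thesis using essA ess_mono by blast
  qed
  moreover have "ess ((G <+>\<^bsub>M\<^esub> A) \<inter> B) B"
  proof -
    have GA: "sub (G <+>\<^bsub>M\<^esub> A)" "G \<subseteq> G <+>\<^bsub>M\<^esub> A" "A \<subseteq> G <+>\<^bsub>M\<^esub> A"
      using sub_sum sum_upper1 sum_upper2 G A by auto
    have "f s \<in> G <+>\<^bsub>M\<^esub> A" if "s \<in> S" for s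
      using sub_cancel_left[OF GA(1), of "f s" s] GS[OF that] that S(2) GA fS(1) sub_carrier
      by blast
    moreover have "y \<in> G <+>\<^bsub>M\<^esub> A" if "y \<in> Y" for y
      using sub_cancel_right[OF GA(1), of y "g y"] GY[OF that] that GA gY(2) Y(1) sub_carrier
      by blast
    ultimately have "Y <+>\<^bsub>M\<^esub> f ` S \<subseteq> (G <+>\<^bsub>M\<^esub> A) \<inter> B"
      using Y fS GA B by (intro sum_least sub_Int) auto
    then show ?thesis using Y(4) ess_mono by blast
  qed
  ultimately show ?thesis using G by (auto simp: ess_graph_def)
qed

section \<open>Projections and the conditions C1 and C3\<close>

lemma direct_sum_iff:
  "internal_direct_sum R M A C \<longleftrightarrow> sub A \<and> sub C \<and> indep A C \<and> A <+>\<^bsub>M\<^esub> C = carrier M"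
  using sub_zero by (auto simp: internal_direct_sum_def indep_def)

lemma ex_projection:
  assumes "internal_direct_sum R M A C"
  shows "\<exists>p. endo p \<and> (\<forall>x\<in>carrier M. p x \<in> A) \<and> (\<forall>a\<in>A. p a = a) \<and>
    (\<forall>x\<in>carrier M. p x = \<zero>\<^bsub>M\<^esub> \<longrightarrow> x \<in> C)"
proof -
  have A: "sub A" and C: "sub C" and AC: "indep A C" "A <+>\<^bsub>M\<^esub> C = carrier M"
    using assms by (auto simp: direct_sum_iff)
  note carr = sub_carrier[OF A] sub_carrier[OF C]
  have uniq: "a = a'" if "a \<in> A" "a' \<in> A" "c \<in> C" "c' \<in> C" "a \<oplus>\<^bsub>M\<^esub> c = a' \<oplus>\<^bsub>M\<^esub> c'" for a a' c c'
  proof -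
    let ?d = "a \<oplus>\<^bsub>M\<^esub> \<ominus>\<^bsub>M\<^esub> a'"
    have d: "?d \<in> A" using that A sub_add sub_neg by blast
    have cm: "a \<in> carrier M" "a' \<in> carrier M" "c \<in> carrier M" "c' \<in> carrier M"
      using that carr by auto
    then have "?d \<oplus>\<^bsub>M\<^esub> c = \<ominus>\<^bsub>M\<^esub> a' \<oplus>\<^bsub>M\<^esub> (a \<oplus>\<^bsub>M\<^esub> c)" by (simp add: M.a_ac)
    also have "\<dots> = c'" using that(5) cm by (simp add: M.r_neg2 M.r_neg1)
    finally have "?d \<in> C" using sub_cancel_right[OF C, of ?d c] that d carr by simp
    then have "?d = \<zero>\<^bsub>M\<^esub>" using AC d indepD by blast
    then show ?thesis using that carr M.minus_equality[of a "\<ominus>\<^bsub>M\<^esub> a'"] by simp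
  qed
  \<comment> \<open>A component in \<open>A\<close> is picked by choice; \<open>uniq\<close> shows
    that it is the only one, so linearity can be read off from any decomposition via
    \<open>p_eq\<close>.\<close>
  define p where "p x = (SOME a. a \<in> A \<and> (\<exists>c\<in>C. x = a \<oplus>\<^bsub>M\<^esub> c))" for x
  have ex: "p x \<in> A \<and> (\<exists>c\<in>C. x = p x \<oplus>\<^bsub>M\<^esub> c)" if "x \<in> carrier M" for x
    unfolding p_def by (rule someI_ex) (use that AC mem_add in blast)
  have p_eq: "p x = a" if "a \<in> A" "c \<in> C" "x = a \<oplus>\<^bsub>M\<^esub> c" for x a c
  proof -
    have "x \<in> carrier M" using that carr by simp
    then show ?thesis using ex uniq that by metis
  qed
  have "p (x \<oplus>\<^bsub>M\<^esub> y) = p x \<oplus>\<^bsub>M\<^esub> p y" if xy: "x \<in> carrier M" "y \<in> carrier M" for x y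
  proof -
    obtain c d where cd: "c \<in> C" "x = p x \<oplus>\<^bsub>M\<^esub> c" "d \<in> C" "y = p y \<oplus>\<^bsub>M\<^esub> d"
      using ex xy by blast
    have pc: "p x \<in> A" "p y \<in> A" using ex xy by auto
    have "(p x \<oplus>\<^bsub>M\<^esub> c) \<oplus>\<^bsub>M\<^esub> (p y \<oplus>\<^bsub>M\<^esub> d) = (p x \<oplus>\<^bsub>M\<^esub> p y) \<oplus>\<^bsub>M\<^esub> (c \<oplus>\<^bsub>M\<^esub> d)"
      using pc cd(1,3) carr by (simp add: M.a_ac)
    then have "x \<oplus>\<^bsub>M\<^esub> y = (p x \<oplus>\<^bsub>M\<^esub> p y) \<oplus>\<^bsub>M\<^esub> (c \<oplus>\<^bsub>M\<^esub> d)" using cd by simp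
    then show ?thesis using p_eq pc cd sub_add A C by blast
  qed
  moreover have "p (r \<odot>\<^bsub>M\<^esub> x) = r \<odot>\<^bsub>M\<^esub> p x" if rx: "r \<in> carrier R" "x \<in> carrier M" for r x
  proof -
    obtain c where c: "c \<in> C" "x = p x \<oplus>\<^bsub>M\<^esub> c" using ex rx by blast
    have pc: "p x \<in> A" using ex rx by auto
    have "r \<odot>\<^bsub>M\<^esub> x = r \<odot>\<^bsub>M\<^esub> p x \<oplus>\<^bsub>M\<^esub> r \<odot>\<^bsub>M\<^esub> c"
      using smult_r_distr[of r "p x" c] pc c rx carr by metis
    then show ?thesis using p_eq pc c rx sub_smult A C by blast
  qed
  ultimately have "endo p" using ex carr by (auto simp: endo_def)
  moreover have "p a = a" if "a \<in> A" for a
    using p_eq[of a "\<zero>\<^bsub>M\<^esub>"] that sub_zero[OF C] carr by simp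
  moreover have "x \<in> C" if "x \<in> carrier M" "p x = \<zero>\<^bsub>M\<^esub>" for x
    using ex[OF that(1)] that(2) carr by auto
  ultimately show ?thesis using ex by blast
qed

lemma sub_restrict:
  assumes "sub D" "sub K" "K \<subseteq> D"
  shows "submodule K R (M\<lparr>carrier := D\<rparr>)"
proof -
  interpret D: left_module R "M\<lparr>carrier := D\<rparr>"
    using submodule_is_left_module left_module_axioms assms(1) .
  show ?thesis
    using assms by (intro D.subI) (auto simp: sub_zero sub_add sub_smult)
qed

text \<open>Passes from essentiality tested inside \<open>D\<close> to \<open>ess\<close>, which
  tests with submodules of \<open>M\<close>: each \<open>K\<close> is replaced by its intersection
  with \<open>D\<close>.\<close>

lemma essential_submodule_imp_ess:
  assumes "sub D" "essential_submodule R (M\<lparr>carrier := D\<rparr>) N" "sub N"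
  shows "N \<subseteq> D" "ess N D"
proof -
  have "submodule N R (M\<lparr>carrier := D\<rparr>)"
    and ess: "\<And>K. \<lbrakk>submodule K R (M\<lparr>carrier := D\<rparr>); N \<inter> K = {\<zero>\<^bsub>M\<^esub>}\<rbrakk> \<Longrightarrow> K = {\<zero>\<^bsub>M\<^esub>}"
    using assms(2) by (auto simp: essential_submodule_def)
  then show ND: "N \<subseteq> D"
    using subgroup.subset[OF submodule.axioms(1)] by fastforce
  show "ess N D"
    unfolding ess_def
  proof (intro allI impI)
    fix K assume K: "sub K" "indep K N"
    have "submodule (K \<inter> D) R (M\<lparr>carrier := D\<rparr>)"
      using sub_restrict sub_Int K assms by simp
    moreover have "N \<inter> (K \<inter> D) = {\<zero>\<^bsub>M\<^esub>}"
      using K ND assms sub_zero unfolding indep_def by blast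
    ultimately show "indep K D" using ess unfolding indep_def by blast
  qed
qed

lemma cond_C1_closure:
  assumes "cond_C1 R M" "sub N"
  shows "\<exists>D. direct_summand R M D \<and> sub D \<and> N \<subseteq> D \<and> ess N D"
proof -
  obtain D where D: "direct_summand R M D" "essential_submodule R (M\<lparr>carrier := D\<rparr>) N"
    using assms by (auto simp: cond_C1_def)
  then have "sub D" by (auto simp: direct_summand_def direct_sum_iff)
  then show ?thesis using D essential_submodule_imp_ess assms by blast
qed

lemma direct_summand_sub: "direct_summand R M A \<Longrightarrow> sub A"
  by (auto simp: direct_summand_def direct_sum_iff)

lemma cond_C3_sum:
  assumes "cond_C3 R M" "direct_summand R M A" "direct_summand R M B" "indep A B"
  shows "direct_summand R M (A <+>\<^bsub>M\<^esub> B)"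
  using assms indep_Int_eq direct_summand_sub by (auto simp: cond_C3_def)

text \<open>By C3 the sum is a summand, and an essential summand is everything, as its complement is
  independent of it and so zero.\<close>

lemma ess_sum_imp_direct_sum:
  assumes "cond_C3 R M" "direct_summand R M A" "direct_summand R M D" "indep A D"
    and ess: "ess (A <+>\<^bsub>M\<^esub> D) (carrier M)"
  shows "internal_direct_sum R M A D"
proof -
  obtain Z where Z: "internal_direct_sum R M (A <+>\<^bsub>M\<^esub> D) Z"
    using cond_C3_sum assms by (auto simp: direct_summand_def)
  then have Zs: "sub Z" "indep Z (A <+>\<^bsub>M\<^esub> D)" "sub (A <+>\<^bsub>M\<^esub> D)"
    by (auto simp: direct_sum_iff indep_sym)
  then have "indep Z (carrier M)" using essD ess by blast
  then have "Z \<subseteq> A <+>\<^bsub>M\<^esub> D"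
    using Zs sub_subset sub_zero unfolding indep_def by blast
  then have "(A <+>\<^bsub>M\<^esub> D) <+>\<^bsub>M\<^esub> Z \<subseteq> A <+>\<^bsub>M\<^esub> D"
    using sum_least Zs by blast
  then have "A <+>\<^bsub>M\<^esub> D = carrier M"
    using Z Zs sub_subset unfolding direct_sum_iff by blast
  then show ?thesis
    using assms direct_summand_sub by (auto simp: direct_sum_iff)
qed

lemma perspectiveI_ess:
  assumes qc: "cond_C1 R M" "cond_C3 R M"
    and A: "direct_summand R M A" and B: "direct_summand R M B" and C: "sub C"
    and ind: "indep C A" "indep C B"
    and ess: "ess (A <+>\<^bsub>M\<^esub> C) (carrier M)" "ess (B <+>\<^bsub>M\<^esub> C) (carrier M)"
  shows "perspective R M A B"
proof -
  obtain D where D: "direct_summand R M D" "C \<subseteq> D" "ess C D"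
    using cond_C1_closure qc C by blast
  \<comment> \<open>Passing from \<open>C\<close> to its closure \<open>D\<close> preserves
    independence from \<open>S\<close> and only enlarges the sum, so the same \<open>D\<close>
    complements both \<open>A\<close> and \<open>B\<close>.\<close>
  have "internal_direct_sum R M S D"
    if "direct_summand R M S" "indep C S" "ess (S <+>\<^bsub>M\<^esub> C) (carrier M)" for S
  proof (rule ess_sum_imp_direct_sum[OF qc(2) that(1) D(1)])
    show "indep S D" using essD D that direct_summand_sub indep_sym by blast
    show "ess (S <+>\<^bsub>M\<^esub> D) (carrier M)"
      using ess_mono[OF that(3) sum_mono[OF order_refl D(2)]] by simp
  qed
  then show ?thesis using assms unfolding perspective_def by blast
qed

section \<open>Splitting off the intersection and embedding the remainders\<close>

text \<open>
  \<open>P\<close> is a closure of \<open>N\<close> plus a complement of \<open>B\<close>. The closure may stick out of \<open>B\<close>, which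
  is harmless and avoids showing that \<open>B\<close> inherits \<open>(C\<^sub>1)\<close>.
\<close>

lemma split_summand:
  assumes qc: "cond_C1 R M" "cond_C3 R M"
    and B: "direct_summand R M B" and N: "sub N" "N \<subseteq> B"
  shows "\<exists>B1 P. internal_direct_sum R M B1 P \<and> B1 \<subseteq> B \<and> indep B1 N \<and>
    ess (N <+>\<^bsub>M\<^esub> B1) B \<and> (\<forall>X. X \<subseteq> B \<longrightarrow> sub X \<longrightarrow> indep X N \<longrightarrow> indep X P)"
proof -
  obtain L where L: "internal_direct_sum R M B L"
    using B by (auto simp: direct_summand_def)
  have sB: "sub B" and sL: "sub L" and BL: "indep B L" "B <+>\<^bsub>M\<^esub> L = carrier M"
    using L by (auto simp: direct_sum_iff)
  have dsL: "direct_summand R M L"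
    using sB sL BL indep_sym sum_comm[OF sB sL] unfolding direct_summand_def direct_sum_iff by metis
  obtain D where D: "direct_summand R M D" "sub D" "N \<subseteq> D" "ess N D"
    using cond_C1_closure qc N by blast
  have NL: "indep N L" using BL N indep_mono by blast
  then have DL: "indep D L" using essD D sL indep_sym by blast
  define P where "P = D <+>\<^bsub>M\<^esub> L"
  have P: "sub P" "D \<subseteq> P" "L \<subseteq> P"
    using sub_sum sum_upper1 sum_upper2 D sL by (auto simp: P_def)
  have essP: "ess (N <+>\<^bsub>M\<^esub> L) P"
    using ess_sum N D sL NL by (auto simp: P_def)
  obtain Z where Z: "sub Z" "indep P Z" "P <+>\<^bsub>M\<^esub> Z = carrier M"
    using cond_C3_sum[OF qc(2) D(1) dsL DL] by (auto simp: P_def direct_summand_def direct_sum_iff)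
  have LZ: "sub (L <+>\<^bsub>M\<^esub> Z)" "L \<subseteq> L <+>\<^bsub>M\<^esub> Z" "Z \<subseteq> L <+>\<^bsub>M\<^esub> Z"
    using sub_sum sum_upper1 sum_upper2 sL Z by auto
  \<comment> \<open>The complement \<open>Z\<close> of \<open>P\<close> need not lie in
    \<open>B\<close>. As \<open>P\<close> contains \<open>L\<close>, \<open>Z\<close> may be shifted
    modulo \<open>L\<close> into \<open>B\<close>: the modular law gives
    \<open>L + Z = L + B1\<close>.\<close>
  define B1 where "B1 = (L <+>\<^bsub>M\<^esub> Z) \<inter> B"
  have B1: "sub B1" "B1 \<subseteq> B" using sub_Int LZ sB by (auto simp: B1_def)
  have zero_right: "U <+>\<^bsub>M\<^esub> V \<subseteq> U" if "sub U" "V \<subseteq> {\<zero>\<^bsub>M\<^esub>}" for U V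
    using that sum_least sub_zero by blast
  \<comment> \<open>By the modular law \<open>W + L\<close> meets \<open>B\<close> only in
    \<open>W\<close>, so adding \<open>L\<close> is invisible from inside \<open>B\<close>.\<close>
  have expand: "indep X (W <+>\<^bsub>M\<^esub> L)"
    if "X \<subseteq> B" "sub W" "W \<subseteq> B" "indep X W" for X W
  proof -
    have "B \<inter> (W <+>\<^bsub>M\<^esub> L) \<subseteq> W"
      using modular_law[OF sB that(2) sL that(3)] zero_right[OF that(2), of "B \<inter> L"] BL(1)
      unfolding indep_def by blast
    then show ?thesis using that unfolding indep_def by blast
  qed
  have "P \<inter> (L <+>\<^bsub>M\<^esub> Z) \<subseteq> L"
    using modular_law[OF P(1) sL Z(1) P(3)] zero_right[OF sL, of "P \<inter> Z"] Z(2)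
    unfolding indep_def by blast
  then have B1P: "indep B1 P"
    using BL(1) unfolding indep_def B1_def by blast
  have B1P_sum: "B1 <+>\<^bsub>M\<^esub> P = carrier M"
  proof -
    have sub: "sub (B1 <+>\<^bsub>M\<^esub> P)" "P \<subseteq> B1 <+>\<^bsub>M\<^esub> P" "B1 \<subseteq> B1 <+>\<^bsub>M\<^esub> P"
      using sub_sum sum_upper1 sum_upper2 B1 P by auto
    have "L <+>\<^bsub>M\<^esub> Z \<subseteq> L <+>\<^bsub>M\<^esub> B1"
      using modular_law[OF LZ(1) sL sB LZ(2)] sum_comm[OF sB sL] BL(2) sub_subset[OF LZ(1)]
      by (auto simp: B1_def)
    also have "\<dots> \<subseteq> B1 <+>\<^bsub>M\<^esub> P"
      using P(3) sub by (intro sum_least[OF sub(1)]) auto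
    finally have "P <+>\<^bsub>M\<^esub> Z \<subseteq> B1 <+>\<^bsub>M\<^esub> P"
      using LZ(3) sub(2) by (intro sum_least[OF sub(1)]) auto
    then show ?thesis using Z(3) sub_subset[OF sub(1)] by blast
  qed
  have X: "indep X P" if "X \<subseteq> B" "sub X" "indep X N" for X
    using expand[OF that(1) N that(3)] essD essP that by blast
  \<comment> \<open>Essentiality of \<open>N\<close> in \<open>D\<close> makes
    \<open>N + L + B1\<close> essential in \<open>D + L + B1\<close>, which is all of
    \<open>M\<close>; \<open>expand\<close> then removes \<open>L\<close> for test submodules cut
    down to \<open>B\<close>.\<close>
  have "ess (N <+>\<^bsub>M\<^esub> B1) B"
    unfolding ess_def
  proof (intro allI impI)
    fix K assume K: "sub K" "indep K (N <+>\<^bsub>M\<^esub> B1)"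
    have sums: "sub (L <+>\<^bsub>M\<^esub> B1)" "sub (N <+>\<^bsub>M\<^esub> B1)" "N <+>\<^bsub>M\<^esub> B1 \<subseteq> B"
      using sub_sum sum_least N B1 sB sL by auto
    have "indep (B1 <+>\<^bsub>M\<^esub> L) D"
      using indep_rotate[OF B1(1) sL D(2) indep_sym[OF DL]] B1P sum_comm[OF D(2) sL]
      by (simp add: P_def)
    then have "indep N (L <+>\<^bsub>M\<^esub> B1)"
      using D(3) indep_sym indep_mono sum_comm[OF B1(1) sL] by (metis order_refl)
    then have "ess (N <+>\<^bsub>M\<^esub> (L <+>\<^bsub>M\<^esub> B1)) (D <+>\<^bsub>M\<^esub> (L <+>\<^bsub>M\<^esub> B1))"
      using ess_sum N D sums by blast
    moreover have "D <+>\<^bsub>M\<^esub> (L <+>\<^bsub>M\<^esub> B1) = carrier M"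
      using B1P_sum sum_comm[OF B1(1) P(1)] sum_assoc[OF D(2) sL B1(1)] by (simp add: P_def)
    moreover have "N <+>\<^bsub>M\<^esub> (L <+>\<^bsub>M\<^esub> B1) = (N <+>\<^bsub>M\<^esub> B1) <+>\<^bsub>M\<^esub> L"
      using sum_assoc[OF N(1) B1(1) sL] sum_comm[OF B1(1) sL] by simp
    moreover have "indep (K \<inter> B) ((N <+>\<^bsub>M\<^esub> B1) <+>\<^bsub>M\<^esub> L)"
      using expand[OF Int_lower2 sums(2,3)] indep_mono[OF K(2) Int_lower1 order_refl] by blast
    ultimately have "indep (K \<inter> B) (carrier M)"
      using essD[OF _ sub_Int[OF K(1) sB]] by simp
    then show "indep K B" using sub_subset[OF sB] unfolding indep_def by blast
  qed
  moreover have "indep B1 N" using B1P D(3) P(2) indep_mono by blast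
  moreover have "internal_direct_sum R M B1 P"
    using B1 P B1P B1P_sum by (auto simp: direct_sum_iff)
  ultimately show ?thesis using B1 X by blast
qed

text \<open>
  The projection \<open>q\<close> onto \<open>B'\<close> along a common complement fixes \<open>A \<inter> B'\<close> and is injective on
  \<open>A\<close>, so it moves \<open>A\<^sub>1\<close> to a submodule of \<open>B\<close> still independent of \<open>A \<inter> B\<close>.
\<close>

lemma ex_embedding:
  assumes "perspective R M A B'" "B' \<subseteq> B" "sub A" "sub B"
    and A1: "sub A1" "A1 \<subseteq> A" "indep A1 (A \<inter> B)"
    and B1: "internal_direct_sum R M B1 P"
    and P: "\<And>X. \<lbrakk>X \<subseteq> B; sub X; indep X (A \<inter> B)\<rbrakk> \<Longrightarrow> indep X P"
  shows "\<exists>f. endo f \<and> f ` A1 \<subseteq> B1 \<and> inj_kernel f A1"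
proof -
  obtain C where C: "internal_direct_sum R M A C" "internal_direct_sum R M B' C"
    using assms(1) by (auto simp: perspective_def)
  obtain q where q: "endo q" "\<And>x. x \<in> carrier M \<Longrightarrow> q x \<in> B'" "\<And>b. b \<in> B' \<Longrightarrow> q b = b"
    "\<And>x. \<lbrakk>x \<in> carrier M; q x = \<zero>\<^bsub>M\<^esub>\<rbrakk> \<Longrightarrow> x \<in> C"
    using ex_projection[OF C(2)] by blast
  obtain p where p: "endo p" "\<And>x. x \<in> carrier M \<Longrightarrow> p x \<in> B1"
    "\<And>x. \<lbrakk>x \<in> carrier M; p x = \<zero>\<^bsub>M\<^esub>\<rbrakk> \<Longrightarrow> x \<in> P"
    using ex_projection[OF B1] by blast
  have A1c: "x \<in> carrier M" if "x \<in> A1" for x using that A1 sub_carrier by blast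
  have q_inj: "inj_kernel q A"
    using C(1) q(4) assms(3) sub_carrier indepD unfolding direct_sum_iff inj_kernel_def by blast
  \<comment> \<open>If q a lies in \<open>A\<close>, it has the same image under \<open>q\<close> as
    a, since \<open>q\<close> fixes \<open>B'\<close>. Injectivity on \<open>A\<close> gives q a =
    a, and \<open>A1\<close> avoids the intersection of \<open>A\<close> and
    \<open>B\<close>.\<close>
  have "indep (q ` A1) (A \<inter> B)"
    unfolding indep_def
  proof
    fix x assume "x \<in> q ` A1 \<inter> (A \<inter> B)"
    then obtain a where a: "a \<in> A1" "x = q a" "x \<in> A" "x \<in> B" by blast
    then have "x \<in> B'" using q(2) A1c by blast
    then have "q x = q a" using q(3) a by simp
    then have "x = a" using inj_kernel_eq[OF q(1) q_inj assms(3)] a A1 by blast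
    then show "x \<in> {\<zero>\<^bsub>M\<^esub>}" using a A1(3) indepD by blast
  qed
  moreover have "q ` A1 \<subseteq> B" using q(2) A1c assms(2) by blast
  ultimately have qP: "indep (q ` A1) P" using P sub_image q(1) A1(1) by blast
  \<comment> \<open>The kernel of \<open>p\<close> lies in \<open>P\<close>, which
    \<open>q A1\<close> avoids.\<close>
  have "inj_kernel (\<lambda>x. p (q x)) A1"
    unfolding inj_kernel_def
  proof (intro ballI impI)
    fix a assume a: "a \<in> A1" "p (q a) = \<zero>\<^bsub>M\<^esub>"
    then have "q a \<in> P" using p(3) endo_closed[OF q(1)] A1c by blast
    then have "q a = \<zero>\<^bsub>M\<^esub>" using qP a indepD by blast
    then show "a = \<zero>\<^bsub>M\<^esub>" using q_inj a A1 inj_kernelD by blast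
  qed
  moreover have "(\<lambda>x. p (q x)) ` A1 \<subseteq> B1" using p(2) endo_closed[OF q(1)] A1c by blast
  ultimately show ?thesis using endo_comp[OF q(1) p(1)] by blast
qed

section \<open>From an essential graph to a common complement\<close>

text \<open>By the modular law \<open>A1 + B1\<close> meets \<open>A\<close> only inside
  \<open>A1\<close>, so \<open>G\<close> can meet \<open>A\<close> only there.\<close>

lemma graph_indep:
  assumes sub: "sub A" "sub A1" "sub B1" "sub G"
    and "A1 \<subseteq> A" "G \<subseteq> A1 <+>\<^bsub>M\<^esub> B1" "indep G A1" "indep B1 A"
  shows "indep G A"
proof -
  have "A \<inter> (A1 <+>\<^bsub>M\<^esub> B1) \<subseteq> A1 <+>\<^bsub>M\<^esub> (A \<inter> B1)"
    using modular_law assms by blast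
  also have "\<dots> \<subseteq> A1"
    using sub assms(8) sum_least[of A1 A1 "A \<inter> B1"] sub_zero by (auto simp: indep_def)
  finally show ?thesis using assms unfolding indep_def by blast
qed

lemma ess_graph_sym: "\<lbrakk>ess_graph A B G; sub A; sub B\<rbrakk> \<Longrightarrow> ess_graph B A G"
  by (auto simp: ess_graph_def sum_comm)

text \<open>\<open>A + G\<close> contains the part of \<open>B1\<close> covered by the graph. This
  part is essential in \<open>B1\<close>, so it can replace \<open>B1\<close> in the essential
  sum.\<close>

lemma graph_complement_ess:
  assumes sub: "sub A" "sub Z" and A1: "sub A1" "A1 \<subseteq> A" and B1: "sub B1"
    and graph: "ess_graph A1 B1 G"
    and ind: "indep B1 (A <+>\<^bsub>M\<^esub> Z)" and ess: "ess (B1 <+>\<^bsub>M\<^esub> (A <+>\<^bsub>M\<^esub> Z)) (carrier M)"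
  shows "ess (A <+>\<^bsub>M\<^esub> (Z <+>\<^bsub>M\<^esub> G)) (carrier M)"
proof -
  have G: "sub G" "ess ((G <+>\<^bsub>M\<^esub> A1) \<inter> B1) B1" using graph by (auto simp: ess_graph_def)
  let ?B = "(G <+>\<^bsub>M\<^esub> A1) \<inter> B1" and ?T = "A <+>\<^bsub>M\<^esub> (Z <+>\<^bsub>M\<^esub> G)"
  have AZ: "sub (A <+>\<^bsub>M\<^esub> Z)" and B: "sub ?B"
    using sub_sum sub_Int sub A1 B1 G by auto
  have "ess (?B <+>\<^bsub>M\<^esub> (A <+>\<^bsub>M\<^esub> Z)) (B1 <+>\<^bsub>M\<^esub> (A <+>\<^bsub>M\<^esub> Z))"
    using ess_sum[OF B B1 AZ _ G(2)] indep_mono[OF ind] by auto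
  then have "ess (?B <+>\<^bsub>M\<^esub> (A <+>\<^bsub>M\<^esub> Z)) (carrier M)" using ess ess_trans by blast
  moreover have "?B <+>\<^bsub>M\<^esub> (A <+>\<^bsub>M\<^esub> Z) \<subseteq> ?T"
  proof -
    have ZG: "sub (Z <+>\<^bsub>M\<^esub> G)" "Z \<subseteq> Z <+>\<^bsub>M\<^esub> G" "G \<subseteq> Z <+>\<^bsub>M\<^esub> G"
      using sub_sum sum_upper1 sum_upper2 sub G by auto
    have T: "sub ?T" "A \<subseteq> ?T" "Z <+>\<^bsub>M\<^esub> G \<subseteq> ?T"
      using sub_sum sum_upper1 sum_upper2 sub ZG by auto
    have "G <+>\<^bsub>M\<^esub> A1 \<subseteq> ?T" "A <+>\<^bsub>M\<^esub> Z \<subseteq> ?T"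
      using T ZG A1 by (intro sum_least; blast)+
    moreover have "?B \<subseteq> ?T" using calculation by blast
    ultimately show ?thesis using sum_least[OF T(1)] by blast
  qed
  ultimately show ?thesis using ess_mono by blast
qed

text \<open>The submodule tested is \<open>Z + G\<close>. The two sides are not symmetric:
  \<open>A\<close> lies in \<open>?T\<close>, but \<open>B\<close> is reached only through its
  essential submodule \<open>?E\<close>, and essentiality transfers the conclusions to
  \<open>B\<close>.\<close>

lemma perspective_if_graph:
  assumes qc: "cond_C1 R M" "cond_C3 R M"
    and A: "direct_summand R M A" and B: "direct_summand R M B"
    and A1: "sub A1" "A1 \<subseteq> A" "indep A1 (A \<inter> B)" "ess ((A \<inter> B) <+>\<^bsub>M\<^esub> A1) A"
    and B1: "sub B1" "B1 \<subseteq> B" "indep B1 (A \<inter> B)" "ess ((A \<inter> B) <+>\<^bsub>M\<^esub> B1) B"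
    and graph: "ess_graph A1 B1 G"
  shows "perspective R M A B"
proof -
  have sA: "sub A" and sB: "sub B" using direct_summand_sub A B by auto
  let ?D = "A \<inter> B"
  have sD: "sub ?D" using sub_Int sA sB by blast
  have A1B: "indep A1 B" and B1A: "indep B1 A" using A1 B1 unfolding indep_def by blast+
  have G: "sub G" "G \<subseteq> A1 <+>\<^bsub>M\<^esub> B1" "indep G A1" "indep G B1"
    using graph by (auto simp: ess_graph_def)
  let ?T = "A <+>\<^bsub>M\<^esub> B1"
  have T: "sub ?T" "A \<subseteq> ?T" "B1 \<subseteq> ?T"
    using sub_sum sum_upper1 sum_upper2 sA B1 by auto
  have GT: "G \<subseteq> ?T" using G(2) sum_mono[OF A1(2) order_refl, of B1] by blast
  obtain Z where Z: "sub Z" "indep Z ?T" "ess (Z <+>\<^bsub>M\<^esub> ?T) (carrier M)"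
    using ex_complement[OF sub_top T(1)] by blast
  \<comment> \<open>\<open>Z\<close> is independent of everything inside \<open>?T\<close>, so it
    may be added to either of two independent submodules there.\<close>
  have Z_indep: "indep (Z <+>\<^bsub>M\<^esub> U) V"
    if "sub U" "sub V" "indep U V" "U \<subseteq> ?T" "V \<subseteq> ?T" for U V
    using indep_rotate[OF Z(1) that(1,2,3)] indep_mono[OF Z(2) order_refl]
      sum_least[OF T(1) that(4,5)] by blast
  let ?E = "?D <+>\<^bsub>M\<^esub> B1"
  have E: "sub ?E" using sub_sum sD B1 by blast
  have EB: "?E \<subseteq> B" by (rule sum_least[OF sB]) (use B1 in auto)
  have ET: "?E \<subseteq> ?T" by (rule sum_least[OF T(1)]) (use T in auto)
  have B1E: "B1 \<subseteq> ?E" using sum_upper2 sD B1 by blast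
  have GE: "indep G ?E"
  proof (rule graph_indep[OF E B1(1) A1(1) G(1) B1E])
    show "G \<subseteq> B1 <+>\<^bsub>M\<^esub> A1" using G(2) sum_comm[OF A1(1) B1(1)] by simp
    show "indep A1 ?E" using A1B EB indep_mono by blast
  qed (rule G(4))
  have ZG: "sub (Z <+>\<^bsub>M\<^esub> G)" using sub_sum Z G by blast
  have ZGA: "indep (Z <+>\<^bsub>M\<^esub> G) A"
    using Z_indep[OF G(1) sA _ GT T(2)] graph_indep[OF sA A1(1) B1(1) G(1) A1(2) G(2,3) B1A]
    by blast
  have ZGB: "indep (Z <+>\<^bsub>M\<^esub> G) B"
    using essD[OF B1(4) ZG] Z_indep[OF G(1) E GE GT ET] by blast
  have ess1: "ess (A <+>\<^bsub>M\<^esub> (Z <+>\<^bsub>M\<^esub> G)) (carrier M)"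
  proof (rule graph_complement_ess[OF sA Z(1) A1(1,2) B1(1) graph])
    show "indep B1 (A <+>\<^bsub>M\<^esub> Z)"
      using indep_sym[OF Z_indep[OF sA B1(1) indep_sym[OF B1A] T(2,3)]] sum_comm[OF Z(1) sA]
      by simp
    have "B1 <+>\<^bsub>M\<^esub> (A <+>\<^bsub>M\<^esub> Z) = (A <+>\<^bsub>M\<^esub> Z) <+>\<^bsub>M\<^esub> B1"
      using sum_comm[OF B1(1) sub_sum[OF sA Z(1)]] .
    also have "\<dots> = Z <+>\<^bsub>M\<^esub> ?T"
      using sum_comm[OF sA Z(1)] sum_assoc[OF Z(1) sA B1(1)] by simp
    finally show "ess (B1 <+>\<^bsub>M\<^esub> (A <+>\<^bsub>M\<^esub> Z)) (carrier M)" using Z(3) by simp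
  qed
  have ess2: "ess (B <+>\<^bsub>M\<^esub> (Z <+>\<^bsub>M\<^esub> G)) (carrier M)"
  proof (rule graph_complement_ess[OF sB Z(1) B1(1,2) A1(1) ess_graph_sym[OF graph A1(1) B1(1)]])
    have A1T: "A1 \<subseteq> ?T" using A1(2) T(2) by blast
    have "indep ?E A1" using A1B EB indep_sym indep_mono by blast
    then have "indep A1 (?E <+>\<^bsub>M\<^esub> Z)"
      using indep_sym[OF Z_indep[OF E A1(1) _ ET A1T]] sum_comm[OF E Z(1)] by simp
    moreover have "ess (?E <+>\<^bsub>M\<^esub> Z) (B <+>\<^bsub>M\<^esub> Z)"
      using ess_sum[OF E sB Z(1) EB B1(4)] indep_mono[OF indep_sym[OF Z(2)] ET order_refl]
      by blast
    ultimately show "indep A1 (B <+>\<^bsub>M\<^esub> Z)" using essD A1(1) by blast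
    \<comment> \<open>To compare with \<open>Z + ?T\<close>, \<open>A\<close> is replaced by its
      essential submodule \<open>?F\<close>. This lies in \<open>B + A1\<close>, so
      \<open>?F + ?W\<close> fits into the sum wanted.\<close>
    let ?F = "?D <+>\<^bsub>M\<^esub> A1" and ?W = "Z <+>\<^bsub>M\<^esub> B1"
    have F: "sub ?F" using sub_sum sD A1 by blast
    have FA: "?F \<subseteq> A" by (rule sum_least[OF sA]) (use A1 in auto)
    have W: "sub ?W" using sub_sum Z B1 by blast
    have "indep A ?W" using indep_sym[OF Z_indep[OF B1(1) sA B1A T(3,2)]] .
    then have "ess (?F <+>\<^bsub>M\<^esub> ?W) (A <+>\<^bsub>M\<^esub> ?W)"
      using ess_sum[OF F sA W FA A1(4)] indep_mono FA by blast
    moreover have "A <+>\<^bsub>M\<^esub> ?W = Z <+>\<^bsub>M\<^esub> ?T"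
      using sum_assoc[OF sA Z(1) B1(1)] sum_comm[OF sA Z(1)] sum_assoc[OF Z(1) sA B1(1)]
      by simp
    ultimately have ess: "ess (?F <+>\<^bsub>M\<^esub> ?W) (carrier M)" using Z(3) ess_trans by simp
    have BZ: "sub (B <+>\<^bsub>M\<^esub> Z)" "B \<subseteq> B <+>\<^bsub>M\<^esub> Z" "Z \<subseteq> B <+>\<^bsub>M\<^esub> Z"
      using sub_sum sum_upper1 sum_upper2 sB Z by auto
    let ?V = "A1 <+>\<^bsub>M\<^esub> (B <+>\<^bsub>M\<^esub> Z)"
    have V: "sub ?V" "A1 \<subseteq> ?V" "B <+>\<^bsub>M\<^esub> Z \<subseteq> ?V"
      using sub_sum sum_upper1 sum_upper2 A1 BZ by auto
    have "?F \<subseteq> ?V" by (rule sum_least[OF V(1)]) (use V BZ in auto)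
    moreover have "?W \<subseteq> ?V" by (rule sum_least[OF V(1)]) (use V BZ B1 in auto)
    ultimately have "?F <+>\<^bsub>M\<^esub> ?W \<subseteq> ?V" by (rule sum_least[OF V(1)])
    then show "ess ?V (carrier M)" using ess ess_mono by blast
  qed
  show ?thesis using perspectiveI_ess[OF qc A B ZG ZGA ZGB ess1 ess2] .
qed

section \<open>Assembling the Schroeder-Bernstein property\<close>

lemma perspective_antisym:
  assumes qc: "cond_C1 R M" "cond_C3 R M"
    and A: "direct_summand R M A" and B: "direct_summand R M B"
    and B': "B' \<subseteq> B" "perspective R M A B'" and A': "A' \<subseteq> A" "perspective R M B A'"
  shows "perspective R M A B"
proof -
  have sA: "sub A" and sB: "sub B" using direct_summand_sub A B by auto
  have sD: "sub (A \<inter> B)" using sub_Int sA sB by blast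
  obtain A1 P where A1: "internal_direct_sum R M A1 P" "A1 \<subseteq> A" "indep A1 (A \<inter> B)"
      "ess ((A \<inter> B) <+>\<^bsub>M\<^esub> A1) A"
    and P: "\<And>X. \<lbrakk>X \<subseteq> A; sub X; indep X (A \<inter> B)\<rbrakk> \<Longrightarrow> indep X P"
    using split_summand[OF qc A sD] by auto
  obtain B1 Q where B1: "internal_direct_sum R M B1 Q" "B1 \<subseteq> B" "indep B1 (A \<inter> B)"
      "ess ((A \<inter> B) <+>\<^bsub>M\<^esub> B1) B"
    and Q: "\<And>X. \<lbrakk>X \<subseteq> B; sub X; indep X (A \<inter> B)\<rbrakk> \<Longrightarrow> indep X Q"
    using split_summand[OF qc B sD] by auto
  have sA1: "sub A1" and sB1: "sub B1" using A1(1) B1(1) by (auto simp: direct_sum_iff)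
  obtain f where f: "endo f" "f ` A1 \<subseteq> B1" "inj_kernel f A1"
    using ex_embedding[OF B'(2,1) sA sB sA1 A1(2,3) B1(1) Q] by blast
  obtain g where g: "endo g" "g ` B1 \<subseteq> A1" "inj_kernel g B1"
    using ex_embedding[OF A'(2,1) sB sA sB1 B1(2) _ A1(1)] P B1(3) by (auto simp: Int_commute)
  have "indep A1 B1" using A1(2,3) B1(2) unfolding indep_def by blast
  then obtain G where "ess_graph A1 B1 G" using ex_ess_graph[OF f g sA1 sB1] by blast
  then show ?thesis
    using perspective_if_graph[OF qc A B sA1 A1(2-4) sB1 B1(2-4)] by blast
qed

end

theorem theorem2p8:
  fixes R :: "('r, 'p) ring_scheme" and M :: "('r, 'm, 'q) module_scheme"
  assumes "left_module R M"
    and "quasi_continuous R M"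
  shows "PSB_property R M"
  using left_module.perspective_antisym[OF assms(1)] assms(2) summand_of_submodule_subset
  unfolding PSB_property_def quasi_continuous_def by blast

end
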